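(* Let $\Lambda=[\mu_1,L_1]\cup[\mu_2,L_2]$ with $0<\mu_1<L_1\le\mu_2<L_2$ and $L_1-\mu_1=L_2-\mu_2$. Consider the cyclical heavy ball method $\mathrm{HB}_2(h_0,h_1;m)$ with $m\in(0,1)$ and step-sizes $h_0,h_1>0$, applied to functions $f\in\mathcal{C}_\Lambda$. Define $$\sigma_2(\lambda)=2\left(\frac{1+m-\lambda h_0}{2\sqrt m}\right)\left(\frac{1+m-\lambda h_1}{2\sqrt m}\right)-1,\qquad \sigma_*=\max_{\lambda\in\left\{\mu_1,L_1,\mu_2,L_2,(1+m)\frac{h_0+h_1}{2h_0h_1}\right\}\cap\Lambda}|\sigma_2(\lambda)|.$$ Then the asymptotic rate factor of this method over $\mathcal{C}_\Lambda$ is $$1-\tau=\begin{cases}\sqrt m & \text{if } \sigma_*\le 1,\\ \sqrt m\,\big(\sigma_*+\sqrt{\sigma_*^2-1}\big)^{1/2} & \text{if } \sigma_*\in\left(1,\frac{1+m^2}{2m}\right),\\ \ge 1 \ (\text{no convergence}) & \text{if } \sigma_*\ge \frac{1+m^2}{2m}.\end{cases}$$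
   Context: For a set $\Lambda\subseteq[\mu,L]$ with $0<\mu<L$, $\mathcal{C}_\Lambda$ is the class of all quadratic functions $f:\mathbb{R}^d\to\mathbb{R}$ (any $d\ge1$) of the form $f(x)=\tfrac12(x-x_* )^\top H(x-x_* )+f_*$ with $H$ symmetric and spectrum $\mathrm{Sp}(H)\subseteq\Lambda$. For a cycle length $K\ge1$, momentum $m\in(0,1)$ and step-sizes $h_0,\dots,h_{K-1}$, the cyclical heavy ball method $\mathrm{HB}_K(h_0,\dots,h_{K-1};m)$ started at $x_0$ produces $x_1=x_0-\frac{h_0}{1+m}\nabla f(x_0)$ and, for $t\ge1$, $x_{t+1}=x_t-h_{t\bmod K}\nabla f(x_t)+m(x_t-x_{t-1})$. For a method producing iterates $(x_t)$, its worst-case rate over $\mathcal{C}_\Lambda$ is $r_t=\sup_{f\in\mathcal{C}_\Lambda,\,x_0\neq x_*}\|x_t-x_*\|/\|x_0-x_*\|$ and its asymptotic rate factor is $1-\tau=\limsup_{t\to\infty}r_t^{1/t}$. *)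

theory Defs
  imports "Jordan_Normal_Form.Spectral_Radius" "HOL-Library.Extended_Real"
begin

definition vnorm :: "real vec \<Rightarrow> real" where
  "vnorm v = sqrt (v \<bullet> v)"

text \<open>The class C_Lambda: a quadratic f(x) = 1/2 (x-xs)^T H (x-xs) + f_* on R^d is determined
  (up to the irrelevant constant f_* ) by (d, H, xs); H symmetric with spectrum in Lambda.
  Its gradient is H (x - xs).\<close>
definition quad_class :: "real set \<Rightarrow> (nat \<times> real mat \<times> real vec) set" where
  "quad_class Lam = {(d, H, xs). d \<ge> 1 \<and> H \<in> carrier_mat d d \<and> transpose_mat H = H
      \<and> spectrum H \<subseteq> Lam \<and> xs \<in> carrier_vec d}"

definition quad_grad :: "real mat \<Rightarrow> real vec \<Rightarrow> real vec \<Rightarrow> real vec" where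
  "quad_grad H xs x = H *\<^sub>v (x - xs)"

text \<open>Cyclical heavy ball HB_K(h_0,...,h_{K-1}; m), K = length hs.
  hb_pair g hs m x0 t = (x_t, x_{t+1}).\<close>
fun hb_pair :: "(real vec \<Rightarrow> real vec) \<Rightarrow> real list \<Rightarrow> real \<Rightarrow> real vec \<Rightarrow> nat
    \<Rightarrow> real vec \<times> real vec" where
  "hb_pair g hs m x0 0 = (x0, x0 - (hs ! 0 / (1 + m)) \<cdot>\<^sub>v g x0)"
| "hb_pair g hs m x0 (Suc t) =
     (let (a, b) = hb_pair g hs m x0 t
      in (b, b - (hs ! (Suc t mod length hs)) \<cdot>\<^sub>v g b + m \<cdot>\<^sub>v (b - a)))"

definition hb_iter :: "(real vec \<Rightarrow> real vec) \<Rightarrow> real list \<Rightarrow> real \<Rightarrow> real vec \<Rightarrow> nat \<Rightarrow> real vec" where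
  "hb_iter g hs m x0 t = fst (hb_pair g hs m x0 t)"

definition hb_worst_rate :: "real set \<Rightarrow> real list \<Rightarrow> real \<Rightarrow> nat \<Rightarrow> real" where
  "hb_worst_rate Lam hs m t =
     (SUP p \<in> {(d, H, xs, x0). (d, H, xs) \<in> quad_class Lam \<and> x0 \<in> carrier_vec d \<and> x0 \<noteq> xs}.
        (case p of (d, H, xs, x0) \<Rightarrow>
          vnorm (hb_iter (quad_grad H xs) hs m x0 t - xs) / vnorm (x0 - xs)))"

definition hb_rate_factor :: "real set \<Rightarrow> real list \<Rightarrow> real \<Rightarrow> ereal" where
  "hb_rate_factor Lam hs m = limsup (\<lambda>t. ereal (root t (hb_worst_rate Lam hs m t)))"

end

(* In an orthonormal eigenbasis of H the error of the method decouples: its component along an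
   eigenvector with eigenvalue l is multiplied by a number P_t(l), so the worst-case rate is
   sup |P_t| over Lambda. Over one cycle of length two,
     P_{t+4} = 2 m sigma(l) P_{t+2} - m^2 P_t,
   so after scaling by m^(t/2) both parity classes satisfy the Chebyshev recurrence with
   characteristic roots z, 1/z where z + 1/z = 2 sigma(l). The scaled sequences are therefore
   bounded by a linear factor times |1/z|^n, and the initial step makes the component of the mode
   (1/z)^n nonzero, so they really grow at that rate. Since |1/z| is increasing in |sigma(l)|, only
   the maximum of |sigma| on Lambda matters; sigma being quadratic, it is attained at an
   endpoint or at the vertex. *)
theory Submission
  imports Defs
begin

subsection \<open>Orthogonal diagonalization\<close>

lemma symmetric_scalar_prod:
  fixes A :: "real mat"
  assumes A: "A \<in> carrier_mat n n" and sym: "transpose_mat A = A"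
    and v: "v \<in> carrier_vec n" and w: "w \<in> carrier_vec n"
  shows "(A *\<^sub>v v) \<bullet> w = v \<bullet> (A *\<^sub>v w)"
  using transpose_vec_mult_scalar[OF A w v] A v w sym
  by (metis comm_scalar_prod mult_mat_vec_carrier)

lemma real_vec_norm_nonneg: "(v :: real vec) \<bullet> v \<ge> 0"
  by (simp add: scalar_prod_def sum_nonneg)

lemma real_vec_norm_pos:
  assumes "(v :: real vec) \<in> carrier_vec n" "v \<noteq> 0\<^sub>v n"
  shows "v \<bullet> v > 0"
  using assms conjugate_square_greater_0_vec[of v n]
  by (simp add: conjugate_vec_def scalar_prod_def)

text \<open>Over the complex numbers an eigenvector \<open>w = a + i b\<close> for some
  \<open>z\<close> exists. Testing symmetry on the pair \<open>a\<close>, \<open>b\<close> gives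
  \<open>Im z * (a . a + b . b) = 0\<close>, so \<open>z\<close> is real and whichever of
  \<open>a\<close>, \<open>b\<close> is nonzero can be normalized to a real eigenvector.\<close>

lemma symmetric_real_eigenvector:
  fixes H :: "real mat"
  assumes H: "H \<in> carrier_mat n n" and sym: "transpose_mat H = H" and n: "n \<noteq> 0"
  obtains v k where "v \<in> carrier_vec n" "v \<bullet> v = 1" "H *\<^sub>v v = k \<cdot>\<^sub>v v"
proof -
  let ?C = "map_mat complex_of_real H"
  have C: "?C \<in> carrier_mat n n" using H by simp
  from spectrum_non_empty[OF C] n obtain z w where "eigenvector ?C w z"
    unfolding spectrum_def eigenvalue_def by auto
  then have w: "w \<in> carrier_vec n" and w0: "w \<noteq> 0\<^sub>v n" and ev: "?C *\<^sub>v w = z \<cdot>\<^sub>v w"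
    using H unfolding eigenvector_def by auto
  define a b where "a = map_vec Re w" and "b = map_vec Im w"
  have a: "a \<in> carrier_vec n" and b: "b \<in> carrier_vec n" using w by (auto simp: a_def b_def)
  have entry: "(\<Sum>j = 0..<n. complex_of_real (H $$ (i,j)) * w $ j) = z * w $ i" if "i < n" for i
  proof -
    have "(?C *\<^sub>v w) $ i = (z \<cdot>\<^sub>v w) $ i" using ev by simp
    then show ?thesis using that w H by (simp add: scalar_prod_def)
  qed
  have Ha: "H *\<^sub>v a = Re z \<cdot>\<^sub>v a + (- Im z) \<cdot>\<^sub>v b"
  proof (rule eq_vecI)
    fix i assume "i < dim_vec (Re z \<cdot>\<^sub>v a + (- Im z) \<cdot>\<^sub>v b)"
    then have i: "i < n" using b by simp
    from arg_cong[OF entry[OF i], of Re]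
    show "(H *\<^sub>v a) $ i = (Re z \<cdot>\<^sub>v a + (- Im z) \<cdot>\<^sub>v b) $ i"
      using i H w by (simp add: scalar_prod_def a_def b_def)
  qed (use H b in auto)
  have Hb: "H *\<^sub>v b = Im z \<cdot>\<^sub>v a + Re z \<cdot>\<^sub>v b"
  proof (rule eq_vecI)
    fix i assume "i < dim_vec (Im z \<cdot>\<^sub>v a + Re z \<cdot>\<^sub>v b)"
    then have i: "i < n" using b by simp
    from arg_cong[OF entry[OF i], of Im]
    show "(H *\<^sub>v b) $ i = (Im z \<cdot>\<^sub>v a + Re z \<cdot>\<^sub>v b) $ i"
      using i H w by (simp add: scalar_prod_def a_def b_def)
  qed (use H b in auto)
  have "(H *\<^sub>v a) \<bullet> b = a \<bullet> (H *\<^sub>v b)"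
    by (rule symmetric_scalar_prod[OF H sym a b])
  then have "Im z * (a \<bullet> a + b \<bullet> b) = 0"
    using a b unfolding Ha Hb
    by (simp add: add_scalar_prod_distrib[of _ n] scalar_prod_add_distrib[of _ n] algebra_simps)
  moreover have nz: "a \<noteq> 0\<^sub>v n \<or> b \<noteq> 0\<^sub>v n"
  proof (rule ccontr)
    assume "\<not> ?thesis"
    then have "a $ i = 0" "b $ i = 0" if "i < n" for i using that by auto
    then have "w $ i = 0" if "i < n" for i
      using that w by (simp add: a_def b_def complex_eq_iff)
    then have "w = 0\<^sub>v n" using w by (intro eq_vecI) auto
    with w0 show False by simp
  qed
  ultimately have "Im z = 0"
    using real_vec_norm_pos[OF a] real_vec_norm_pos[OF b]
      real_vec_norm_nonneg[of a] real_vec_norm_nonneg[of b] by auto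
  then have "H *\<^sub>v a = Re z \<cdot>\<^sub>v a" "H *\<^sub>v b = Re z \<cdot>\<^sub>v b"
    using a b unfolding Ha Hb by auto
  with nz a b obtain u where u: "u \<in> carrier_vec n" "u \<noteq> 0\<^sub>v n" "H *\<^sub>v u = Re z \<cdot>\<^sub>v u"
    by blast
  define v where "v = (1 / sqrt (u \<bullet> u)) \<cdot>\<^sub>v u"
  have pos: "u \<bullet> u > 0" using real_vec_norm_pos u by blast
  have "v \<bullet> v = 1" using pos u by (simp add: v_def)
  moreover have "H *\<^sub>v v = Re z \<cdot>\<^sub>v v"
    using u H by (simp add: v_def mult_mat_vec smult_smult_assoc mult.commute)
  moreover have "v \<in> carrier_vec n" using u by (simp add: v_def)
  ultimately show thesis using that by blast
qed

text \<open>The Householder reflection in the hyperplane orthogonal to \<open>v - e\<^sub>0\<close>.\<close>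
lemma orthogonal_symmetric_mat_with_first_col:
  fixes v :: "real vec"
  assumes v: "v \<in> carrier_vec n" and norm: "v \<bullet> v = 1" and n: "0 < n"
  obtains W where "W \<in> carrier_mat n n" "transpose_mat W = W" "W * W = 1\<^sub>m n" "col W 0 = v"
\<comment> \<open>In the first case the unit vector \<open>v\<close> is \<open>e_0\<close> itself,
  the reflection direction \<open>v - e_0\<close> vanishes, and the identity serves instead.\<close>
proof (cases "v $ 0 = 1")
  case True
  have "v \<bullet> v = v $ 0 * v $ 0 + (\<Sum>i\<in>{1..<n}. v $ i * v $ i)"
    using v n by (simp add: scalar_prod_def sum.atLeast_Suc_lessThan)
  with norm True have "(\<Sum>i\<in>{1..<n}. v $ i * v $ i) = 0" by simp
  then have "\<forall>i\<in>{1..<n}. v $ i * v $ i = 0"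
    by (subst (asm) sum_nonneg_eq_0_iff) auto
  then have "col (1\<^sub>m n) 0 = v" using True v n by (intro eq_vecI) auto
  then show thesis using that[of "1\<^sub>m n"] by auto
next
  case False
  define u where "u i = v $ i - (if i = 0 then 1 else 0)" for i
  \<comment> \<open>Since \<open>u = v - e_0\<close> has squared length
    \<open>2 * (1 - v $ 0)\<close>, this is \<open>2 / (u . u)\<close>, the coefficient that makes
    \<open>I - c u u^T\<close> a reflection.\<close>
  define c where "c = 1 / (1 - v $ 0)"
  have u0: "c * u 0 = -1" using False by (simp add: u_def c_def field_simps)
  have "(\<Sum>k = 0..<n. u k * u k) = (v $ 0 - 1)^2 + (\<Sum>k = 1..<n. v $ k * v $ k)"
    using n by (simp add: u_def sum.atLeast_Suc_lessThan power2_eq_square)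
  also have "\<dots> = v \<bullet> v + 1 - 2 * v $ 0"
    using v n by (simp add: scalar_prod_def sum.atLeast_Suc_lessThan power2_eq_square algebra_simps)
  finally have "(\<Sum>k = 0..<n. u k * u k) = 2 * (1 - v $ 0)" using norm by simp
  then have uu: "c * (\<Sum>k = 0..<n. u k * u k) = 2" using False by (simp add: c_def field_simps)
  define W where "W = mat n n (\<lambda>(i,j). (if i = j then 1 else 0) - c * u i * u j)"
  have W: "W \<in> carrier_mat n n" by (simp add: W_def)
  have "transpose_mat W = W" by (rule eq_matI) (auto simp: W_def)
  moreover have "col W 0 = v"
  proof (rule eq_vecI)
    fix i assume "i < dim_vec v"
    then have "i < n" using v by simp
    then have "col W 0 $ i = (if i = 0 then 1 else 0) - u i * (c * u 0)"
      using n by (simp add: W_def)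
    then show "col W 0 $ i = v $ i" unfolding u0 by (simp add: u_def)
  qed (use v W in auto)
  moreover have "W * W = 1\<^sub>m n"
  proof (rule eq_matI)
    fix i j assume "i < dim_row (1\<^sub>m n :: real mat)" "j < dim_col (1\<^sub>m n :: real mat)"
    then have i: "i < n" and j: "j < n" by auto
    have "(W * W) $$ (i,j) = (\<Sum>k = 0..<n. W $$ (i,k) * W $$ (k,j))"
      using i j W by (simp add: scalar_prod_def)
    also have "\<dots> = (\<Sum>k = 0..<n. (if k = i then (if k = j then 1 else 0) else 0)
        - (if k = i then c * u k * u j else 0) - (if k = j then c * u i * u k else 0)
        + c * u i * u j * (c * (u k * u k)))"
      using i j by (intro sum.cong) (auto simp: W_def algebra_simps)
    also have "\<dots> = (if i = j then 1 else 0) - 2 * (c * u i * u j)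
        + c * u i * u j * (c * (\<Sum>k = 0..<n. u k * u k))"
      using i j by (simp add: sum.distrib sum_subtractf sum_distrib_left)
    also have "\<dots> = 1\<^sub>m n $$ (i,j)" using i j unfolding uu by simp
    finally show "(W * W) $$ (i,j) = 1\<^sub>m n $$ (i,j)" .
  qed (use W in auto)
  ultimately show thesis using that W by blast
qed

text \<open>Deflation: conjugating by a symmetric involution \<open>W\<close> whose first column is
  a unit eigenvector splits off a 1-by-1 block. The induction hypothesis diagonalizes the remaining
  symmetric block by some \<open>U'\<close>, and \<open>W\<close> times the block sum of 1 and
  \<open>U'\<close> diagonalizes \<open>H\<close>.\<close>

lemma symmetric_mat_orthogonally_diagonalizable:
  fixes H :: "real mat"
  assumes "H \<in> carrier_mat n n" "transpose_mat H = H"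
  shows "\<exists>U D. U \<in> carrier_mat n n \<and> D \<in> carrier_mat n n \<and> diagonal_mat D
    \<and> transpose_mat U * U = 1\<^sub>m n \<and> H * U = U * D"
  using assms
proof (induction n arbitrary: H)
  case 0
  then show ?case by (intro exI[of _ "1\<^sub>m 0"]) (auto simp: diagonal_mat_def)
next
  case (Suc n)
  note H = Suc.prems(1) and sym = Suc.prems(2)
  obtain v k where v: "v \<in> carrier_vec (Suc n)" "v \<bullet> v = 1" "H *\<^sub>v v = k \<cdot>\<^sub>v v"
    using symmetric_real_eigenvector[OF H sym] by blast
  obtain W where W: "W \<in> carrier_mat (Suc n) (Suc n)" and Wt: "transpose_mat W = W"
    and WW: "W * W = 1\<^sub>m (Suc n)" and W0: "col W 0 = v"
    using orthogonal_symmetric_mat_with_first_col[OF v(1,2)] by blast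
  define A where "A = W * (H * W)"
  have A: "A \<in> carrier_mat (Suc n) (Suc n)" using W H by (simp add: A_def)
  have At: "transpose_mat A = A"
    using W H by (simp add: A_def transpose_mult[of _ "Suc n" "Suc n" _ "Suc n"] Wt sym)
  note col_mult = col_mult2[of _ "Suc n" "Suc n" _ "Suc n" 0]
  have "col A 0 = W *\<^sub>v col (H * W) 0"
    unfolding A_def using W H by (intro col_mult) auto
  also have "col (H * W) 0 = H *\<^sub>v v"
    unfolding W0[symmetric] using W H by (intro col_mult) auto
  also have "W *\<^sub>v (H *\<^sub>v v) = k \<cdot>\<^sub>v (W *\<^sub>v col W 0)"
    unfolding v(3) W0 by (rule mult_mat_vec[OF W v(1)])
  also have "W *\<^sub>v col W 0 = col (W * W) 0"
    using W by (intro col_mult[symmetric]) auto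
  also have "\<dots> = unit_vec (Suc n) 0" unfolding WW by simp
  finally have colA: "col A 0 = k \<cdot>\<^sub>v unit_vec (Suc n) 0" .
  have A0: "A $$ (i,0) = (if i = 0 then k else 0)" if "i < Suc n" for i
    using arg_cong[OF colA, of "\<lambda>x. x $ i"] that A by simp
  \<comment> \<open>Symmetry of \<open>A\<close> transfers the shape of the first column to the
    first row, which yields the block form.\<close>
  have A0': "A $$ (0,j) = (if j = 0 then k else 0)" if "j < Suc n" for j
    using A0[OF that] arg_cong[OF At, of "\<lambda>X. X $$ (0,j)"] that A by simp
  define H' where "H' = mat n n (\<lambda>(i,j). A $$ (Suc i, Suc j))"
  have H': "H' \<in> carrier_mat n n" by (simp add: H'_def)
  have "transpose_mat H' = H'"
  proof (rule eq_matI)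
    fix i j assume "i < dim_row H'" "j < dim_col H'"
    then show "transpose_mat H' $$ (i,j) = H' $$ (i,j)"
      using arg_cong[OF At, of "\<lambda>X. X $$ (Suc i, Suc j)"] A by (simp add: H'_def)
  qed (auto simp: H'_def)
  from Suc.IH[OF H' this] obtain U' D' where U': "U' \<in> carrier_mat n n"
    and D': "D' \<in> carrier_mat n n" "diagonal_mat D'"
    and ortho: "transpose_mat U' * U' = 1\<^sub>m n" and HU': "H' * U' = U' * D'" by blast
  define K where "K = mat 1 1 (\<lambda>_. k)"
  have K: "K \<in> carrier_mat 1 1" by (simp add: K_def)
  define B where "B = four_block_mat (1\<^sub>m 1) (0\<^sub>m 1 n) (0\<^sub>m n 1) U'"
  define D where "D = four_block_mat K (0\<^sub>m 1 n) (0\<^sub>m n 1) D'"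
  have Ab: "A = four_block_mat K (0\<^sub>m 1 n) (0\<^sub>m n 1) H'"
    by (rule eq_matI) (use A A0 A0' in \<open>auto simp: K_def H'_def\<close>)
  have B: "B \<in> carrier_mat (Suc n) (Suc n)" using U' by (auto simp: B_def)
  have D: "D \<in> carrier_mat (Suc n) (Suc n)" using D' K by (auto simp: D_def)
  have diagD: "diagonal_mat D"
    using D' unfolding diagonal_mat_def D_def K_def by auto
  have AB: "A * B = B * D"
    unfolding Ab B_def D_def
    using K H' U' D' HU'
    by (simp add: mult_four_block_mat[of _ 1 1 _ n _ n _ _ 1 _ n])
  have BB: "transpose_mat B * B = 1\<^sub>m (Suc n)"
    unfolding B_def using U' ortho four_block_one_mat[of 1 n]
    by (simp add: transpose_four_block_mat[of _ 1 1 _ n _ n]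
        mult_four_block_mat[of _ 1 1 _ n _ n _ _ 1 _ n])
  define U where "U = W * B"
  have U: "U \<in> carrier_mat (Suc n) (Suc n)" using W B by (simp add: U_def)
  note assoc = assoc_mult_mat[of _ "Suc n" "Suc n" _ "Suc n" _ "Suc n"]
  \<comment> \<open>\<open>W\<close> is its own inverse: \<open>U = W * B\<close> therefore inherits
    orthonormal columns from \<open>B\<close>, and \<open>A = W * (H * W)\<close> can be undone to
    recover \<open>H\<close>.\<close>
  have cancel: "W * (W * X) = X" if "X \<in> carrier_mat (Suc n) (Suc n)" for X
    using assoc[OF W W that] WW that by simp
  have "transpose_mat U * U = transpose_mat B * (W * (W * B))"
    using W B by (simp add: U_def transpose_mult[of _ "Suc n" "Suc n" _ "Suc n"] Wt assoc)
  also have "\<dots> = 1\<^sub>m (Suc n)" using cancel[OF B] BB by simp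
  finally have "transpose_mat U * U = 1\<^sub>m (Suc n)" .
  moreover have "H * U = U * D"
  proof -
    have HWB: "H * (W * B) \<in> carrier_mat (Suc n) (Suc n)" using H W B by simp
    have "H * U = W * (W * (H * (W * B)))" using cancel[OF HWB] by (simp add: U_def)
    also have "W * (H * (W * B)) = A * B"
      using W H B by (simp add: A_def assoc)
    also have "W * (A * B) = U * D" using W B D by (simp add: U_def AB assoc)
    finally show ?thesis .
  qed
  ultimately show ?case using U D diagD by blast
qed

subsection \<open>Worst-case rate and residual polynomials\<close>

lemma diagonal_mult_vec_index:
  assumes "D \<in> carrier_mat n n" "diagonal_mat D" "y \<in> carrier_vec n" "i < n"
  shows "(D *\<^sub>v y) $ i = D $$ (i,i) * (y $ i :: real)"
proof -
  have "(D *\<^sub>v y) $ i = (\<Sum>j = 0..<n. D $$ (i,j) * y $ j)"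
    using assms by (simp add: scalar_prod_def)
  also have "\<dots> = (\<Sum>j = 0..<n. if j = i then D $$ (i,i) * y $ i else 0)"
    using assms by (intro sum.cong) (auto simp: diagonal_mat_def)
  finally show ?thesis using assms by simp
qed

text \<open>The residual polynomial: the error recursion of the method with the Hessian replaced by
  the scalar \<open>l\<close> and initial error 1.\<close>

fun hb_poly :: "real list \<Rightarrow> real \<Rightarrow> real \<Rightarrow> nat \<Rightarrow> real" where
  "hb_poly hs m l 0 = 1"
| "hb_poly hs m l (Suc 0) = 1 - hs ! 0 / (1 + m) * l"
| "hb_poly hs m l (Suc (Suc t)) =
     (1 + m - hs ! (Suc t mod length hs) * l) * hb_poly hs m l (Suc t) - m * hb_poly hs m l t"

text \<open>If the error is \<open>U y\<close> then the gradient is \<open>H U y = U D y\<close>, so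
  every step is a linear combination of images under \<open>U\<close> and acts on the
  \<open>i\<close>-th coordinate through \<open>D $$ (i,i)\<close> only.\<close>

lemma hb_pair_diagonalized:
  fixes z :: "nat \<Rightarrow> real" and m :: real and hs :: "real list"
  assumes H: "H \<in> carrier_mat n n" and U: "U \<in> carrier_mat n n"
    and D: "D \<in> carrier_mat n n" "diagonal_mat D" and HU: "H * U = U * D"
    and xs: "xs \<in> carrier_vec n"
  defines "x \<equiv> \<lambda>t. xs + U *\<^sub>v vec n (\<lambda>i. hb_poly hs m (D $$ (i,i)) t * z i)"
  shows "hb_pair (quad_grad H xs) hs m (x 0) t = (x t, x (Suc t))"
proof -
  define y where "y t = vec n (\<lambda>i. hb_poly hs m (D $$ (i,i)) t * z i)" for t
  have y: "y t \<in> carrier_vec n" for t by (simp add: y_def)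
  have x_y: "x t = xs + U *\<^sub>v y t" for t by (simp add: x_def y_def)
  have x_index: "x t $ i = xs $ i + (\<Sum>j = 0..<n. U $$ (i,j) * y t $ j)" if "i < n" for t i
    using that xs U y by (simp add: x_y scalar_prod_def y_def)
  have dim_x: "dim_vec (x t) = n" for t using U by (simp add: x_y)
  have grad: "quad_grad H xs (x t) = U *\<^sub>v (D *\<^sub>v y t)" for t
  proof -
    have "x t - xs = U *\<^sub>v y t"
      by (rule eq_vecI) (use xs U in \<open>auto simp: x_y\<close>)
    then have "quad_grad H xs (x t) = (H * U) *\<^sub>v y t"
      using H U y by (simp add: quad_grad_def)
    then show ?thesis unfolding HU using U D(1) y by simp
  qed
  have grad_index: "quad_grad H xs (x t) $ i = (\<Sum>j = 0..<n. U $$ (i,j) * (D $$ (j,j) * y t $ j))"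
    if "i < n" for t i
    using that U D(1) y diagonal_mult_vec_index[OF D y]
    by (simp add: grad scalar_prod_def)
  have dim_grad: "dim_vec (quad_grad H xs (x t)) = n" for t
    using U by (simp add: grad)
  have step0: "x 0 - (hs ! 0 / (1 + m)) \<cdot>\<^sub>v quad_grad H xs (x 0) = x (Suc 0)"
  proof (rule eq_vecI)
    fix i assume "i < dim_vec (x (Suc 0))"
    then have i: "i < n" by (simp add: dim_x)
    then show "(x 0 - (hs ! 0 / (1 + m)) \<cdot>\<^sub>v quad_grad H xs (x 0)) $ i = x (Suc 0) $ i"
      by (simp add: dim_x dim_grad x_index grad_index sum_distrib_left sum_subtractf[symmetric])
        (auto simp: y_def algebra_simps intro!: sum.cong)
  qed (simp add: dim_x dim_grad)
  have step: "x (Suc t) - (hs ! (Suc t mod length hs)) \<cdot>\<^sub>v quad_grad H xs (x (Suc t))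
      + m \<cdot>\<^sub>v (x (Suc t) - x t) = x (Suc (Suc t))" (is "?l = _") for t
  proof (rule eq_vecI)
    fix i assume "i < dim_vec (x (Suc (Suc t)))"
    then have i: "i < n" by (simp add: dim_x)
    define h where "h = hs ! (Suc t mod length hs)"
    have "?l $ i = xs $ i + ((\<Sum>j = 0..<n. U $$ (i,j) * y (Suc t) $ j)
        - h * (\<Sum>j = 0..<n. U $$ (i,j) * (D $$ (j,j) * y (Suc t) $ j))
        + m * ((\<Sum>j = 0..<n. U $$ (i,j) * y (Suc t) $ j) - (\<Sum>j = 0..<n. U $$ (i,j) * y t $ j)))"
      using i by (simp add: dim_x dim_grad x_index grad_index h_def)
    also have "\<dots> = xs $ i + (\<Sum>j = 0..<n. U $$ (i,j) * y (Suc (Suc t)) $ j)"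
      unfolding sum_distrib_left sum_subtractf[symmetric] sum.distrib[symmetric]
      by (intro arg_cong[of _ _ "(+) _"] sum.cong)
        (auto simp: y_def h_def[symmetric] algebra_simps)
    finally show "?l $ i = x (Suc (Suc t)) $ i" using i by (simp add: x_index)
  qed (simp add: dim_x dim_grad)
  show ?thesis
    by (induction t) (simp_all add: step0 step)
qed

text \<open>\<open>U\<close> is an isometry, so the error norm equals that of its coordinates, and
  the \<open>i\<close>-th coordinate is scaled by the residual polynomial at an eigenvalue, which
  lies in \<open>Lam\<close>.\<close>

lemma hb_iter_error_le:
  assumes quad: "(d, H, xs) \<in> quad_class Lam" and x0: "x0 \<in> carrier_vec d"
    and C: "\<And>l. l \<in> Lam \<Longrightarrow> \<bar>hb_poly hs m l t\<bar> \<le> C" "0 \<le> C"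
  shows "vnorm (hb_iter (quad_grad H xs) hs m x0 t - xs) \<le> C * vnorm (x0 - xs)"
proof -
  from quad have H: "H \<in> carrier_mat d d" and sym: "transpose_mat H = H"
    and spec: "spectrum H \<subseteq> Lam" and xs: "xs \<in> carrier_vec d"
    unfolding quad_class_def by auto
  from symmetric_mat_orthogonally_diagonalizable[OF H sym] obtain U D where
    U: "U \<in> carrier_mat d d" and D: "D \<in> carrier_mat d d" "diagonal_mat D"
    and UU: "transpose_mat U * U = 1\<^sub>m d" and HU: "H * U = U * D" by blast
  \<comment> \<open>The inverse on the other side is what recovers \<open>x0 - xs\<close> from its
    coordinates \<open>z\<close>.\<close>
  have UU': "U * transpose_mat U = 1\<^sub>m d"
    by (rule mat_mult_left_right_inverse[OF _ U UU]) (use U in simp)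
  have isometry: "(U *\<^sub>v w) \<bullet> (U *\<^sub>v w) = w \<bullet> w" if w: "w \<in> carrier_vec d" for w
  proof -
    have "(U *\<^sub>v w) \<bullet> (U *\<^sub>v w) = (transpose_mat U *\<^sub>v (U *\<^sub>v w)) \<bullet> w"
      using transpose_vec_mult_scalar[OF U w, of "U *\<^sub>v w"] U w by simp
    also have "transpose_mat U *\<^sub>v (U *\<^sub>v w) = (transpose_mat U * U) *\<^sub>v w"
      using U w by (subst assoc_mult_mat_vec[of _ d d _ d]) auto
    finally show ?thesis using UU w by simp
  qed
  \<comment> \<open>Column \<open>i\<close> of \<open>U\<close> is an eigenvector for
    \<open>D $$ (i,i)\<close>; it is nonzero because it has unit length.\<close>
  have eigen: "D $$ (i,i) \<in> Lam" if i: "i < d" for i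
  proof -
    have "H *\<^sub>v col U i = col (U * D) i"
      unfolding HU[symmetric] using H U i by (intro col_mult2[of _ d d _ d, symmetric]) auto
    also have "\<dots> = D $$ (i,i) \<cdot>\<^sub>v col U i"
    proof (rule eq_vecI)
      fix j assume "j < dim_vec (D $$ (i,i) \<cdot>\<^sub>v col U i)"
      then have j: "j < d" using U by simp
      have "col (U * D) i $ j = (\<Sum>k = 0..<d. U $$ (j,k) * D $$ (k,i))"
        using U D i j by (simp add: scalar_prod_def)
      also have "\<dots> = (\<Sum>k = 0..<d. if k = i then U $$ (j,i) * D $$ (i,i) else 0)"
        using D i by (intro sum.cong) (auto simp: diagonal_mat_def)
      finally show "col (U * D) i $ j = (D $$ (i,i) \<cdot>\<^sub>v col U i) $ j"
        using U i j by simp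
    qed (use U D in auto)
    finally have "H *\<^sub>v col U i = D $$ (i,i) \<cdot>\<^sub>v col U i" .
    moreover have "col U i \<noteq> 0\<^sub>v d"
    proof
      assume "col U i = 0\<^sub>v d"
      moreover have "col U i \<bullet> col U i = (transpose_mat U * U) $$ (i,i)" using U i by simp
      ultimately show False using UU i by simp
    qed
    ultimately have "eigenvalue H (D $$ (i,i))"
      using H U i unfolding eigenvalue_def eigenvector_def by (intro exI[of _ "col U i"]) auto
    with spec show ?thesis by (auto simp: spectrum_def)
  qed
  define z where "z = transpose_mat U *\<^sub>v (x0 - xs)"
  have z: "z \<in> carrier_vec d" using U xs x0 by (simp add: z_def)
  have "U *\<^sub>v z = (U * transpose_mat U) *\<^sub>v (x0 - xs)"
    unfolding z_def using U xs x0 by (subst assoc_mult_mat_vec[of _ d d _ d]) auto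
  then have Uz: "U *\<^sub>v z = x0 - xs" using UU' x0 xs by simp
  define y where "y t = vec d (\<lambda>i. hb_poly hs m (D $$ (i,i)) t * z $ i)" for t
  have y0: "y 0 = z" using z by (intro eq_vecI) (auto simp: y_def)
  have "x0 = xs + U *\<^sub>v y 0" unfolding y0 Uz using x0 xs by (intro eq_vecI) auto
  then have "hb_iter (quad_grad H xs) hs m x0 t = xs + U *\<^sub>v y t"
    using hb_pair_diagonalized[OF H U D HU xs, of hs m "\<lambda>i. z $ i" t]
    by (simp add: hb_iter_def y_def)
  then have "hb_iter (quad_grad H xs) hs m x0 t - xs = U *\<^sub>v y t"
    using xs U by (intro eq_vecI) (auto simp: y_def)
  then have "vnorm (hb_iter (quad_grad H xs) hs m x0 t - xs) = sqrt (y t \<bullet> y t)"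
    by (simp add: vnorm_def isometry y_def)
  also have "y t \<bullet> y t \<le> C\<^sup>2 * (z \<bullet> z)"
  proof -
    have "y t \<bullet> y t = (\<Sum>i = 0..<d. (hb_poly hs m (D $$ (i,i)) t)\<^sup>2 * (z $ i)\<^sup>2)"
      by (simp add: scalar_prod_def y_def power2_eq_square algebra_simps)
    also have "\<dots> \<le> (\<Sum>i = 0..<d. C\<^sup>2 * (z $ i)\<^sup>2)"
    proof (intro sum_mono mult_right_mono)
      fix i assume "i \<in> {0..<d}"
      then have "\<bar>hb_poly hs m (D $$ (i,i)) t\<bar>\<^sup>2 \<le> C\<^sup>2"
        using C eigen by (intro power_mono) auto
      then show "(hb_poly hs m (D $$ (i,i)) t)\<^sup>2 \<le> C\<^sup>2" by simp
    qed simp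
    also have "\<dots> = C\<^sup>2 * (z \<bullet> z)"
      using z by (simp add: scalar_prod_def sum_distrib_left power2_eq_square)
    finally show ?thesis .
  qed
  then have "sqrt (y t \<bullet> y t) \<le> sqrt (C\<^sup>2 * (z \<bullet> z))" by simp
  also have "\<dots> = C * sqrt (z \<bullet> z)" using C by (simp add: real_sqrt_mult)
  also have "z \<bullet> z = (x0 - xs) \<bullet> (x0 - xs)" using isometry[OF z] by (simp add: Uz)
  finally show ?thesis by (simp add: vnorm_def)
qed

section \<open>One-dimensional quadratics and the supremum defining the worst-case rate\<close>

lemma one_dim_mem_quad_class:
  assumes "l \<in> Lam"
  shows "(1, mat 1 1 (\<lambda>_. l), 0\<^sub>v 1) \<in> quad_class Lam"
proof -
  have "k = l" if ev: "eigenvalue (mat 1 1 (\<lambda>_. l)) k" for k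
  proof -
    from ev obtain v where v: "v \<in> carrier_vec 1" "v \<noteq> 0\<^sub>v 1"
      and "mat 1 1 (\<lambda>_. l) *\<^sub>v v = k \<cdot>\<^sub>v v"
      unfolding eigenvalue_def eigenvector_def by auto
    then have "(mat 1 1 (\<lambda>_. l) *\<^sub>v v) $ 0 = (k \<cdot>\<^sub>v v) $ 0" by simp
    then have "l * v $ 0 = k * v $ 0" using v(1) by (simp add: scalar_prod_def)
    moreover have "v $ 0 \<noteq> 0"
    proof
      assume "v $ 0 = 0"
      then have "v = 0\<^sub>v 1" using v(1) by (intro eq_vecI) auto
      with v(2) show False by simp
    qed
    ultimately show ?thesis by simp
  qed
  moreover have "transpose_mat (mat 1 1 (\<lambda>_. l)) = mat 1 1 (\<lambda>_. l)" by (rule eq_matI) auto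
  ultimately show ?thesis using assms by (auto simp: quad_class_def spectrum_def)
qed

text \<open>The source of all lower bounds: a 1-by-1 Hessian is already diagonal, and starting at
  distance 1 from the minimizer 0 leaves exactly the residual polynomial as error.\<close>

lemma hb_iter_one_dim:
  "vnorm (hb_iter (quad_grad (mat 1 1 (\<lambda>_. l)) (0\<^sub>v 1)) hs m (unit_vec 1 0) t - 0\<^sub>v 1)
    / vnorm (unit_vec 1 0 - 0\<^sub>v 1) = \<bar>hb_poly hs m l t\<bar>"
proof -
  let ?H = "mat 1 1 (\<lambda>_. l)"
  have x: "0\<^sub>v 1 + 1\<^sub>m 1 *\<^sub>v vec 1 (\<lambda>i. hb_poly hs m (?H $$ (i,i)) t * 1)
      = vec 1 (\<lambda>_. hb_poly hs m l t)" for t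
    by (rule eq_vecI) (auto simp: scalar_prod_def)
  have "unit_vec 1 0 = vec 1 (\<lambda>_. hb_poly hs m l 0)" by (rule eq_vecI) auto
  then have "hb_iter (quad_grad ?H (0\<^sub>v 1)) hs m (unit_vec 1 0) t = vec 1 (\<lambda>_. hb_poly hs m l t)"
    using hb_pair_diagonalized[of ?H 1 "1\<^sub>m 1" ?H "0\<^sub>v 1" hs m "\<lambda>_. 1" t]
    unfolding x by (simp add: hb_iter_def diagonal_mat_def)
  then show ?thesis
    by (simp add: vnorm_def scalar_prod_def)
qed

lemma hb_error_ratio_le:
  assumes "(d, H, xs) \<in> quad_class Lam" "x0 \<in> carrier_vec d" "x0 \<noteq> xs"
    and "\<And>l. l \<in> Lam \<Longrightarrow> \<bar>hb_poly hs m l t\<bar> \<le> C" "0 \<le> C"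
  shows "vnorm (hb_iter (quad_grad H xs) hs m x0 t - xs) / vnorm (x0 - xs) \<le> C"
proof -
  have xs: "xs \<in> carrier_vec d" using assms(1) by (simp add: quad_class_def)
  have "x0 - xs \<noteq> 0\<^sub>v d"
  proof
    assume *: "x0 - xs = 0\<^sub>v d"
    have "x0 = xs"
    proof (rule eq_vecI)
      fix i assume "i < dim_vec xs"
      then show "x0 $ i = xs $ i"
        using arg_cong[OF *, of "\<lambda>v. v $ i"] assms(2) xs by simp
    qed (use assms(2) xs in auto)
    with assms(3) show False by simp
  qed
  then have "vnorm (x0 - xs) > 0"
    using real_vec_norm_pos[of "x0 - xs" d] assms(2) xs by (simp add: vnorm_def)
  then show ?thesis
    using hb_iter_error_le[OF assms(1,2,4,5)] by (simp add: divide_le_eq)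
qed

lemma hb_worst_rate_le:
  assumes "Lam \<noteq> {}" and C: "\<And>l. l \<in> Lam \<Longrightarrow> \<bar>hb_poly hs m l t\<bar> \<le> C"
  shows "hb_worst_rate Lam hs m t \<le> C"
proof -
  from assms obtain l where l: "l \<in> Lam" by blast
  have "0 \<le> C" using C[OF l] by simp
  \<comment> \<open>Bounding the real-valued \<open>SUP\<close> by an upper bound of its members
    requires a nonempty index set.\<close>
  have "(1, mat 1 1 (\<lambda>_. l), 0\<^sub>v 1, unit_vec 1 0) \<in>
      {(d, H, xs, x0). (d, H, xs) \<in> quad_class Lam \<and> x0 \<in> carrier_vec d \<and> x0 \<noteq> xs}" (is "_ \<in> ?A")
    using one_dim_mem_quad_class[OF l] by simp
  then have "?A \<noteq> {}" by blast
  then show ?thesis unfolding hb_worst_rate_def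
    using hb_error_ratio_le[OF _ _ _ C \<open>0 \<le> C\<close>] by (intro cSUP_least) auto
qed

text \<open>The one-dimensional instance is a member of the family under the \<open>SUP\<close>. The
  uniform bound \<open>C\<close> is there to make that family bounded above, so that the real
  supremum dominates its members.\<close>

lemma hb_poly_le_worst_rate:
  assumes l: "l \<in> Lam" and C: "\<And>l. l \<in> Lam \<Longrightarrow> \<bar>hb_poly hs m l t\<bar> \<le> C"
  shows "\<bar>hb_poly hs m l t\<bar> \<le> hb_worst_rate Lam hs m t"
proof -
  have "0 \<le> C" using C[OF l] by simp
  let ?p = "(1, mat 1 1 (\<lambda>_. l), 0\<^sub>v 1, unit_vec 1 0) :: nat \<times> real mat \<times> real vec \<times> real vec"
  show ?thesis unfolding hb_worst_rate_def
  proof (rule cSUP_upper2[where x = ?p])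
    show "bdd_above ((\<lambda>p. case p of (d, H, xs, x0) \<Rightarrow>
          vnorm (hb_iter (quad_grad H xs) hs m x0 t - xs) / vnorm (x0 - xs)) `
        {(d, H, xs, x0). (d, H, xs) \<in> quad_class Lam \<and> x0 \<in> carrier_vec d \<and> x0 \<noteq> xs})"
      using hb_error_ratio_le[OF _ _ _ C \<open>0 \<le> C\<close>] by (intro bdd_aboveI2[where M = C]) auto
  next
    show "?p \<in> {(d, H, xs, x0). (d, H, xs) \<in> quad_class Lam \<and> x0 \<in> carrier_vec d \<and> x0 \<noteq> xs}"
      using one_dim_mem_quad_class[OF l] by simp
  next
    show "\<bar>hb_poly hs m l t\<bar> \<le> (case ?p of (d, H, xs, x0) \<Rightarrow>
        vnorm (hb_iter (quad_grad H xs) hs m x0 t - xs) / vnorm (x0 - xs))"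
      using hb_iter_one_dim[of l hs m t] by simp
  qed
qed

subsection \<open>Growth of the Chebyshev recurrence\<close>

text \<open>For \<open>x\<close> at least 1 this is \<open>exp (arcosh x)\<close>, the larger root
  of \<open>r + 1/r = 2 x\<close> and the growth factor of the Chebyshev polynomials at
  \<open>x\<close>.\<close>

definition cheb_growth :: "real \<Rightarrow> real" where
  "cheb_growth x = x + sqrt (x\<^sup>2 - 1)"

lemma cheb_growth_one [simp]: "cheb_growth 1 = 1"
  by (simp add: cheb_growth_def)

lemma cheb_growth_mono:
  assumes "1 \<le> x" "x \<le> y"
  shows "cheb_growth x \<le> cheb_growth y"
  unfolding cheb_growth_def using assms
  by (intro add_mono real_sqrt_le_mono diff_mono power_mono) auto

lemma cheb_growth_ge_one: "1 \<le> x \<Longrightarrow> 1 \<le> cheb_growth x"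
  using cheb_growth_mono[of 1 x] by simp

text \<open>The argument is \<open>(m + 1/m) / 2\<close>, so the reciprocal roots are
  \<open>m\<close> and \<open>1/m\<close>. This locates the threshold at which the rate
  \<open>sqrt m * sqrt (cheb_growth x)\<close> reaches 1.\<close>

lemma cheb_growth_joukowski:
  assumes "0 < m" "m \<le> 1"
  shows "cheb_growth ((1 + m\<^sup>2) / (2 * m)) = 1 / m"
proof -
  have "((1 + m\<^sup>2) / (2 * m))\<^sup>2 - 1 = ((1 - m\<^sup>2) / (2 * m))\<^sup>2"
    using assms by (simp add: field_simps power2_eq_square)
  moreover have "(1 - m\<^sup>2) / (2 * m) \<ge> 0" using assms by (simp add: power_le_one)
  ultimately have "sqrt (((1 + m\<^sup>2) / (2 * m))\<^sup>2 - 1) = (1 - m\<^sup>2) / (2 * m)"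
    by (simp only: real_sqrt_abs abs_of_nonneg)
  then show ?thesis
    using assms by (simp add: cheb_growth_def field_simps)
qed

text \<open>\<open>z\<close> is a root of \<open>z^2 - 2 s z + 1\<close> in the closed unit disc.
  The two roots are reciprocal: conjugate on the unit circle if \<open>s\<close> has modulus at most
  1, real otherwise. Working with complex \<open>z\<close> lets both regimes share the later
  estimates.\<close>

lemma joukowski_preimage:
  fixes s :: real
  obtains z :: complex where "z \<noteq> 0" "norm z \<le> 1" "z + inverse z = 2 * of_real s"
    "inverse (norm z) = cheb_growth (max 1 \<bar>s\<bar>)"
proof (cases "\<bar>s\<bar> \<le> 1")
  case True
  define z where "z = Complex s (sqrt (1 - s\<^sup>2))"
  have sq: "s\<^sup>2 \<le> 1" using True by (simp add: abs_square_le_1)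
  then have n: "norm z = 1" by (simp add: z_def cmod_def)
  then have "z \<noteq> 0" by auto
  moreover have "inverse z = cnj z"
    using n by (simp add: inverse_complex_def z_def cmod_def sq complex_eq_iff)
  then have "z + inverse z = 2 * of_real s" by (simp add: complex_eq_iff z_def)
  ultimately show thesis using that[of z] n True by (simp add: max_def)
next
  case False
  define r where "r = cheb_growth \<bar>s\<bar>"
  have r1: "r \<ge> 1" unfolding r_def using False by (intro cheb_growth_ge_one) simp
  have "sqrt (s\<^sup>2 - 1) * sqrt (s\<^sup>2 - 1) = s\<^sup>2 - 1"
    using False abs_square_le_1[of s] by simp
  then have "r * r + 1 = 2 * \<bar>s\<bar> * r"
    unfolding r_def cheb_growth_def by (simp add: algebra_simps power2_eq_square)
  then have r: "r + inverse r = 2 * \<bar>s\<bar>" using r1 by (simp add: field_simps)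
  \<comment> \<open>\<open>inverse r\<close> solves the equation for the absolute value of
    \<open>s\<close>; since the equation is odd, the sign of \<open>s\<close> carries over.\<close>
  define x where "x = sgn s * inverse r"
  have "x + inverse x = sgn s * (r + inverse r)"
    using False by (simp add: x_def sgn_if)
  then have x: "x + inverse x = 2 * s" unfolding r by (simp add: sgn_if)
  have "s \<noteq> 0" using False by auto
  then have x0: "x \<noteq> 0" and ax: "\<bar>x\<bar> = inverse r"
    using r1 by (simp_all add: x_def sgn_if)
  have "of_real x + inverse (of_real x :: complex) = of_real (x + inverse x)" by simp
  then have "of_real x + inverse (of_real x :: complex) = 2 * of_real s" unfolding x by simp
  moreover have "norm (of_real x :: complex) \<le> 1" using ax r1 by (simp add: inverse_le_1_iff)
  moreover have "inverse (norm (of_real x :: complex)) = cheb_growth (max 1 \<bar>s\<bar>)"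
    using ax False r1 by (simp add: max_def r_def)
  ultimately show thesis using that[of "of_real x"] x0 by simp
qed

text \<open>With \<open>E\<close> the shift operator, the recurrence factors as
  \<open>(E - 1/z) (E - z) q = 0\<close>, so \<open>(E - z) q\<close> is geometric with ratio
  \<open>1/z\<close>. This form also covers the double root \<open>z = 1/z\<close>.\<close>

lemma cheb_recurrence_first_order:
  fixes q :: "nat \<Rightarrow> real" and z :: complex
  assumes rec: "\<And>n. q (Suc (Suc n)) = 2 * s * q (Suc n) - q n"
    and z: "z \<noteq> 0" "z + inverse z = 2 * of_real s"
  shows "of_real (q (Suc n)) - z * of_real (q n) = inverse z ^ n * (of_real (q 1) - z * of_real (q 0))"
proof (induction n)
  case (Suc n)
  have "of_real (q (Suc (Suc n))) = (z + inverse z) * of_real (q (Suc n)) - of_real (q n)"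
    unfolding z(2) by (simp add: rec)
  moreover have "inverse z * (of_real (q (Suc n)) - z * of_real (q n))
      = inverse z * of_real (q (Suc n)) - of_real (q n)"
    using z(1) by (simp add: right_diff_distrib)
  ultimately have "of_real (q (Suc (Suc n))) - z * of_real (q (Suc n))
      = inverse z * (of_real (q (Suc n)) - z * of_real (q n))"
    by (simp add: distrib_right)
  then show ?case unfolding Suc by simp
qed simp

text \<open>As \<open>z\<close> has modulus at most 1, each step adds at most one geometric term to
  the bound; the linear factor counts these terms. Stating the growth through \<open>x\<close>
  rather than \<open>s\<close> allows one rate for a whole range of \<open>s\<close>.\<close>

lemma cheb_recurrence_upper:
  fixes q :: "nat \<Rightarrow> real"
  assumes rec: "\<And>n. q (Suc (Suc n)) = 2 * s * q (Suc n) - q n"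
    and R: "1 \<le> x" "\<bar>s\<bar> \<le> x"
  shows "\<bar>q n\<bar> \<le> real (Suc n) * (\<bar>q 0\<bar> + \<bar>q 1\<bar>) * cheb_growth x ^ n"
proof -
  obtain z :: complex where z: "z \<noteq> 0" "norm z \<le> 1" "z + inverse z = 2 * of_real s"
    "inverse (norm z) = cheb_growth (max 1 \<bar>s\<bar>)" by (rule joukowski_preimage)
  let ?R = "cheb_growth x" and ?D = "\<bar>q 0\<bar> + \<bar>q 1\<bar>"
  have R1: "?R \<ge> 1" using R by (simp add: cheb_growth_ge_one)
  have zR: "inverse (norm z) \<le> ?R" unfolding z(4) using R by (intro cheb_growth_mono) auto
  have contract: "norm (z * of_real y) \<le> \<bar>y\<bar>" for y :: real
    using mult_right_mono[OF z(2), of "\<bar>y\<bar>"] by (simp add: norm_mult)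
  have D: "norm (of_real (q 1) - z * of_real (q 0)) \<le> ?D"
    using norm_triangle_ineq4[of "of_real (q 1)" "z * of_real (q 0)"] contract[of "q 0"] by simp
  show ?thesis
  proof (induction n)
    case 0
    show ?case by simp
  next
    case (Suc n)
    have "norm (of_real (q (Suc n)) - z * of_real (q n)) \<le> ?R ^ n * ?D"
      unfolding cheb_recurrence_first_order[where q = q and s = s, OF rec z(1,3)] norm_mult norm_power norm_inverse
      using R1 by (intro mult_mono power_mono zR D) auto
    moreover have "\<bar>q (Suc n)\<bar> \<le> norm (of_real (q (Suc n)) - z * of_real (q n)) + norm (z * of_real (q n))"
      using norm_triangle_ineq[of "of_real (q (Suc n)) - z * of_real (q n)" "z * of_real (q n)"] by simp
    ultimately have "\<bar>q (Suc n)\<bar> \<le> ?R ^ n * ?D + real (Suc n) * ?D * ?R ^ n"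
      using Suc contract[of "q n"] by linarith
    also have "\<dots> = real (Suc (Suc n)) * ?D * ?R ^ n" by (simp add: algebra_simps)
    also have "\<dots> \<le> real (Suc (Suc n)) * ?D * ?R ^ Suc n"
      using R1 by (intro mult_left_mono power_increasing) auto
    finally show ?case .
  qed
qed

text \<open>Writing \<open>2 s = z + 1/z\<close>, the coefficient of the dominant mode \<open>z\<^sup>-\<^sup>n\<close> is proportional to
  \<open>q 1 - z\<close>, and the initial value makes this \<open>(1 + z) (1/z - m) / (1 + m)\<close>. The second factor
  cannot vanish because \<open>|z| \<le> 1\<close>; if the first one does, the sequence is \<open>(-1)\<^sup>n\<close>.\<close>
lemma cheb_recurrence_lower:
  fixes q :: "nat \<Rightarrow> real"
  assumes rec: "\<And>n. q (Suc (Suc n)) = 2 * s * q (Suc n) - q n"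
    and q0: "q 0 = 1" and q1: "q 1 = 2 * (1 + s) / (1 + m) - 1" and m: "0 < m" "m < 1"
  shows "\<exists>c>0. \<forall>n. \<bar>q n\<bar> + \<bar>q (Suc n)\<bar> \<ge> c * cheb_growth (max 1 \<bar>s\<bar>) ^ n"
proof -
  obtain z :: complex where z: "z \<noteq> 0" "norm z \<le> 1" "z + inverse z = 2 * of_real s"
    "inverse (norm z) = cheb_growth (max 1 \<bar>s\<bar>)" by (rule joukowski_preimage)
  show ?thesis
  proof (cases "z = -1")
    case True
    then have s: "s = -1" using z(3) by (simp add: complex_eq_iff)
    have "q n = (-1) ^ n \<and> q (Suc n) = (-1) ^ Suc n" for n
      by (induction n) (use q0 q1 in \<open>simp_all add: rec s\<close>)
    then have "\<bar>q n\<bar> = 1" for n by (simp add: power_abs)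
    then show ?thesis by (intro exI[of _ 1]) (simp add: s)
  next
    case False
    let ?d = "of_real (q 1) - z"
    have "(1 + m) * q 1 = 2 + 2 * s - (1 + m)"
      unfolding q1 using m by (simp add: field_simps)
    from arg_cong[OF this, of complex_of_real]
    have "(1 + of_real m) * ?d = (2 + 2 * of_real s) - (1 + of_real m) * (1 + z)"
      by (simp add: algebra_simps)
    \<comment> \<open>Uses \<open>2 + 2 s = 2 + z + 1/z = (1 + z) (1 + 1/z)\<close>.\<close>
    also have "\<dots> = (1 + z) * (inverse z - of_real m)"
      unfolding z(3)[symmetric] using z(1) by (simp add: field_simps)
    finally have d: "(1 + of_real m) * ?d = (1 + z) * (inverse z - of_real m)" .
    have "inverse z \<noteq> of_real m"
    proof
      assume "inverse z = of_real m"
      then have "inverse (norm z) = m" using m by (metis norm_inverse norm_of_real abs_of_pos)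
      moreover have "inverse (norm z) \<ge> 1" using z(1,2) by (simp add: one_le_inverse_iff)
      ultimately show False using m by simp
    qed
    moreover have "1 + z \<noteq> 0" using False by (metis add_eq_0_iff)
    ultimately have d0: "?d \<noteq> 0" using d by (metis mult_zero_right mult_eq_0_iff right_minus_eq)
    \<comment> \<open>Two consecutive terms are combined because a single term can vanish in the
      oscillating regime, whereas \<open>q (Suc n) - z q n\<close> has a known modulus.\<close>
    have "norm ?d * cheb_growth (max 1 \<bar>s\<bar>) ^ n \<le> \<bar>q n\<bar> + \<bar>q (Suc n)\<bar>" for n
    proof -
      have "norm ?d * cheb_growth (max 1 \<bar>s\<bar>) ^ n = norm (of_real (q (Suc n)) - z * of_real (q n))"
        unfolding cheb_recurrence_first_order[where q = q and s = s, OF rec z(1,3)] z(4)[symmetric]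
        by (simp add: norm_mult norm_power norm_inverse q0)
      also have "\<dots> \<le> \<bar>q (Suc n)\<bar> + norm z * \<bar>q n\<bar>"
        using norm_triangle_ineq4[of "of_real (q (Suc n))" "z * of_real (q n)"]
        by (simp add: norm_mult)
      also have "norm z * \<bar>q n\<bar> \<le> 1 * \<bar>q n\<bar>" using z(2) by (intro mult_right_mono) auto
      finally show ?thesis by simp
    qed
    with d0 show ?thesis by (intro exI[of _ "norm ?d"]) auto
  qed
qed

subsection \<open>Asymptotic rate\<close>

definition hb_sigma :: "real \<Rightarrow> real \<Rightarrow> real \<Rightarrow> real \<Rightarrow> real" where
  "hb_sigma h0 h1 m l = 2 * ((1 + m - l * h0) / (2 * sqrt m)) * ((1 + m - l * h1) / (2 * sqrt m)) - 1"

lemma hb_sigma_eq: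
  assumes "0 < m"
  shows "2 * m * hb_sigma h0 h1 m l = (1 + m - l * h0) * (1 + m - l * h1) - 2 * m"
proof -
  have "2 * (a / (2 * r)) * (b / (2 * r)) = a * b / (2 * (r * r))" for a b r :: real
    by (simp add: field_simps)
  then have "hb_sigma h0 h1 m l = (1 + m - l * h0) * (1 + m - l * h1) / (2 * (sqrt m * sqrt m)) - 1"
    unfolding hb_sigma_def by (simp only:)
  also have "sqrt m * sqrt m = m" using assms by simp
  finally show ?thesis using assms by (simp add: field_simps)
qed

text \<open>Two consecutive steps use each step-size once, so the product of their coefficients is
  the same from either parity. Eliminating the terms of the other parity leaves a recurrence with
  constant coefficients.\<close>

lemma hb_poly_two_step:
  assumes "0 < m"
  shows "hb_poly [h0, h1] m l (t + 4)
    = 2 * m * hb_sigma h0 h1 m l * hb_poly [h0, h1] m l (t + 2) - m\<^sup>2 * hb_poly [h0, h1] m l t"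
proof -
  define P where "P = hb_poly [h0, h1] m l"
  define c where "c t = 1 + m - [h0, h1] ! (t mod 2) * l" for t
  have rec: "P (Suc (Suc t)) = c (Suc t) * P (Suc t) - m * P t" for t
    by (simp add: P_def c_def numeral_2_eq_2)
  have "c (Suc t) * c (Suc (Suc t)) = (1 + m - l * h0) * (1 + m - l * h1)"
    by (cases "even t") (auto simp: c_def mod_Suc even_iff_mod_2_eq_zero odd_iff_mod_2_eq_one algebra_simps)
  then have cc: "c (Suc t) * c (Suc (Suc t)) = 2 * m * hb_sigma h0 h1 m l + 2 * m"
    using hb_sigma_eq[OF assms, of h0 h1 l] by simp
  have c2: "c (Suc (Suc (Suc t))) = c (Suc t)" by (simp add: c_def mod_Suc)
  have "P (t + 4) = c (Suc t) * (c (Suc (Suc t)) * P (t + 2) - m * P (Suc t)) - m * P (t + 2)"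
    by (simp add: numeral_eq_Suc rec[of "Suc (Suc t)"] c2 rec[of "Suc t"])
  also have "\<dots> = (c (Suc t) * c (Suc (Suc t))) * P (t + 2) - m * (c (Suc t) * P (Suc t)) - m * P (t + 2)"
    by (simp add: algebra_simps)
  \<comment> \<open>The one-step recurrence at \<open>t\<close>, solved for the term of the other
    parity.\<close>
  also have "c (Suc t) * P (Suc t) = P (t + 2) + m * P t"
    using rec[of t] by simp
  finally show ?thesis unfolding cc P_def by (simp add: algebra_simps power2_eq_square)
qed

text \<open>Dividing by \<open>sqrt m ^ t\<close> normalizes the coefficients
  \<open>2 m sigma\<close> and \<open>m^2\<close> to \<open>2 sigma\<close> and 1; \<open>j\<close>
  selects the parity class.\<close>

lemma hb_poly_scaled_recurrence:
  fixes h0 h1 m l :: real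
  assumes m: "0 < m"
  defines "q \<equiv> \<lambda>j n. hb_poly [h0, h1] m l (2 * n + j) / sqrt m ^ (2 * n + j)"
  shows "q j (Suc (Suc n)) = 2 * hb_sigma h0 h1 m l * q j (Suc n) - q j n"
proof -
  define S where "S = sqrt m ^ (2 * n + j)"
  have S: "S \<noteq> 0" using m by (simp add: S_def)
  have sq: "sqrt m * sqrt m = m" using m by simp
  have p1: "sqrt m ^ (2 * Suc n + j) = m * S" using sq by (simp add: S_def)
  have p2: "sqrt m ^ (2 * Suc (Suc n) + j) = m * (m * S)"
  proof -
    have "2 * Suc (Suc n) + j = Suc (Suc (Suc (Suc (2 * n + j))))" by simp
    then have "sqrt m ^ (2 * Suc (Suc n) + j) = (sqrt m * sqrt m) * ((sqrt m * sqrt m) * S)"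
      by (simp only: power_Suc S_def mult.assoc)
    then show ?thesis unfolding sq .
  qed
  have "hb_poly [h0, h1] m l (2 * Suc (Suc n) + j)
    = 2 * m * hb_sigma h0 h1 m l * hb_poly [h0, h1] m l (2 * Suc n + j)
      - m\<^sup>2 * hb_poly [h0, h1] m l (2 * n + j)"
    using hb_poly_two_step[OF m, of h0 h1 l "2 * n + j"] by (simp add: numeral_eq_Suc)
  moreover have "(2 * m * s * a - m\<^sup>2 * b) / (m * (m * S)) = 2 * s * (a / (m * S)) - b / S"
    for a b s
    using S m by (simp add: field_simps power2_eq_square)
  ultimately show ?thesis unfolding q_def p1 p2 S_def[symmetric] by (simp only:)
qed

section \<open>Uniform upper and pointwise lower bounds for the residual polynomials\<close>

lemma continuous_on_hb_poly: "continuous_on A (\<lambda>l. hb_poly hs m l t)"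
  \<comment> \<open>Only the recursion pattern in \<open>t\<close> matters: \<open>l\<close> is
    bound in the claim, and 0 is a placeholder for it.\<close>
  by (induction hs m "0 :: real" t rule: hb_poly.induct)
    (auto intro!: continuous_on_diff continuous_on_mult continuous_on_const continuous_on_id
      simp del: times_divide_eq_left)

lemma hb_poly_bounded_on_compact:
  assumes "compact Lam"
  shows "\<exists>K. \<forall>l\<in>Lam. \<bar>hb_poly hs m l t\<bar> \<le> K"
proof (cases "Lam = {}")
  case False
  then show ?thesis
    using continuous_attains_sup[OF assms False continuous_on_rabs[OF continuous_on_hb_poly]] by blast
qed simp

text \<open>Each parity class obeys the Chebyshev bound. Its starting values are continuous in
  \<open>l\<close>, so compactness of \<open>Lam\<close> makes the constant independent of
  \<open>l\<close>.\<close>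

lemma hb_poly_upper:
  assumes Lam: "compact Lam" and m: "0 < m"
    and s: "1 \<le> s" "\<And>l. l \<in> Lam \<Longrightarrow> \<bar>hb_sigma h0 h1 m l\<bar> \<le> s"
  shows "\<exists>K>0. \<forall>l\<in>Lam. \<forall>t. \<bar>hb_poly [h0, h1] m l t\<bar>
    \<le> K * real (Suc t) * (sqrt m * sqrt (cheb_growth s)) ^ t"
proof -
  let ?P = "hb_poly [h0, h1] m" and ?R = "cheb_growth s"
  obtain B where B: "\<And>l t. l \<in> Lam \<Longrightarrow> \<bar>?P l t\<bar> \<le> B t"
    using hb_poly_bounded_on_compact[OF Lam] by metis
  define E where "E t = B t / sqrt m ^ t" for t
  \<comment> \<open>The starting values of the two parity classes have indices \<open>j\<close> and
    \<open>2 + j\<close> with \<open>j < 2\<close>, that is 0 to 3; the summand 1 makes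
    \<open>K\<close> positive.\<close>
  define K where "K = 1 + (\<Sum>t<4. \<bar>E t\<bar>)"
  have E: "\<bar>?P l t / sqrt m ^ t\<bar> \<le> E t" if "l \<in> Lam" for l t
    using B[OF that] m by (simp add: E_def divide_right_mono)
  have R1: "1 \<le> ?R" using s by (simp add: cheb_growth_ge_one)
  have "\<bar>?P l t\<bar> \<le> K * real (Suc t) * (sqrt m * sqrt ?R) ^ t" if l: "l \<in> Lam" for l t
  proof -
    define j n where "j = t mod 2" and "n = t div 2"
    have t: "t = 2 * n + j" and j: "j < 2" by (auto simp: j_def n_def)
    define q where "q n = ?P l (2 * n + j) / sqrt m ^ (2 * n + j)" for n
    have q01: "\<bar>q 0\<bar> \<le> E j" "\<bar>q 1\<bar> \<le> E (2 + j)"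
      using E[OF l, of j] E[OF l, of "2 + j"] by (simp_all add: q_def)
    have "\<bar>q n\<bar> \<le> real (Suc n) * (\<bar>q 0\<bar> + \<bar>q 1\<bar>) * ?R ^ n"
      using s(1) s(2)[OF l] hb_poly_scaled_recurrence[OF m, of h0 h1 l, folded q_def]
      by (intro cheb_recurrence_upper) (auto simp: q_def)
    also have "\<dots> \<le> real (Suc t) * K * sqrt ?R ^ t"
    proof (intro mult_mono)
      have "\<bar>q 0\<bar> + \<bar>q 1\<bar> \<le> \<bar>E j\<bar> + \<bar>E (2 + j)\<bar>"
        using q01 by linarith
      also have "\<dots> \<le> K"
        using j by (auto simp: K_def eval_nat_numeral less_Suc_eq)
      finally show "\<bar>q 0\<bar> + \<bar>q 1\<bar> \<le> K" .
      have "?R ^ n = sqrt ?R ^ (2 * n)" using R1 by (simp add: power_mult)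
      also have "\<dots> \<le> sqrt ?R ^ t" using R1 by (intro power_increasing) (auto simp: t)
      finally show "?R ^ n \<le> sqrt ?R ^ t" .
    qed (use R1 in \<open>auto simp: t K_def intro!: add_nonneg_nonneg sum_nonneg\<close>)
    finally have "\<bar>?P l t\<bar> / sqrt m ^ t \<le> real (Suc t) * K * sqrt ?R ^ t"
      using m by (simp add: q_def t)
    then show ?thesis using m by (simp add: power_mult_distrib divide_le_eq mult_ac)
  qed
  moreover have "K > 0" by (simp add: K_def add_pos_nonneg sum_nonneg)
  ultimately show ?thesis by blast
qed

text \<open>The even-indexed subsequence suffices: its first two scaled values are exactly the
  initial data of \<open>cheb_recurrence_lower\<close>.\<close>

lemma hb_poly_lower:
  fixes h0 h1 m l :: real
  assumes m: "0 < m" "m < 1"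
  defines "w \<equiv> \<lambda>t. hb_poly [h0, h1] m l t / sqrt m ^ t"
  shows "\<exists>c>0. \<forall>n. \<bar>w (2 * n)\<bar> + \<bar>w (2 * Suc n)\<bar> \<ge> c * cheb_growth (max 1 \<bar>hb_sigma h0 h1 m l\<bar>) ^ n"
proof -
  let ?s = "hb_sigma h0 h1 m l"
  have "w 2 = ((1 + m - h1 * l) * (1 - h0 / (1 + m) * l) - m) / m"
    using m by (simp add: w_def numeral_2_eq_2)
  \<comment> \<open>The division by \<open>1 + m\<close> in the first step of the method turns its
    factor into \<open>(1 + m - l * h0) / (1 + m)\<close>, so the full cycle product appears already
    at \<open>t = 2\<close>.\<close>
  also have "\<dots> = ((1 + m - l * h0) * (1 + m - l * h1) / (1 + m) - m) / m"
    using m by (simp add: field_simps)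
  also have "(1 + m - l * h0) * (1 + m - l * h1) = 2 * m * ?s + 2 * m"
    using hb_sigma_eq[OF m(1), of h0 h1 l] by simp
  also have "(2 * m * ?s + 2 * m) / (1 + m) - m = m * (2 * (1 + ?s) / (1 + m) - 1)"
    by (simp add: algebra_simps)
  also have "\<dots> / m = 2 * (1 + ?s) / (1 + m) - 1" using m by simp
  finally have w2: "w 2 = 2 * (1 + ?s) / (1 + m) - 1" .
  show ?thesis
  proof (rule cheb_recurrence_lower[where q = "\<lambda>n. w (2 * n)"])
    show "w (2 * Suc (Suc n)) = 2 * ?s * w (2 * Suc n) - w (2 * n)" for n
      using hb_poly_scaled_recurrence[OF m(1), of h0 h1 l n 0] by (simp only: w_def add_0_right)
  qed (use m w2 in \<open>auto simp: w_def\<close>)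
qed

section \<open>From geometric bounds to the limsup of roots\<close>

lemma limsup_root_le:
  fixes a :: "nat \<Rightarrow> real"
  assumes le: "\<And>t. a t \<le> K * real (Suc t) * G ^ t" and K: "0 < K" and G: "0 \<le> G"
  shows "limsup (\<lambda>t. ereal (root t (a t))) \<le> ereal G"
proof -
  have "(\<lambda>t. root t (2 * K) * root t (real t) * G) \<longlonglongrightarrow> 1 * 1 * G"
    using K by (intro tendsto_intros LIMSEQ_root LIMSEQ_root_const) auto
  then have lim: "(\<lambda>t. ereal (root t (2 * K) * root t (real t) * G)) \<longlonglongrightarrow> ereal G" by simp
  have "limsup (\<lambda>t. ereal (root t (a t))) \<le> limsup (\<lambda>t. ereal (root t (2 * K) * root t (real t) * G))"
  proof (rule Limsup_mono, rule eventually_mono[OF eventually_gt_at_top[of 0]])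
    fix t :: nat assume t: "0 < t"
    \<comment> \<open>Replacing \<open>Suc t\<close> by \<open>2 * t\<close> for positive
      \<open>t\<close> reduces the linear factor to \<open>root t (real t)\<close>, which tends to
      1.\<close>
    have "K * real (Suc t) \<le> K * (2 * real t)" using K t by (intro mult_left_mono) auto
    then have "K * real (Suc t) * G ^ t \<le> K * (2 * real t) * G ^ t"
      using G by (intro mult_right_mono) auto
    then have "root t (a t) \<le> root t (2 * K * real t * G ^ t)"
      using le[of t] t by (intro real_root_le_mono) (auto simp: mult_ac)
    also have "\<dots> = root t (2 * K) * root t (real t) * G"
      using t G by (simp add: real_root_mult real_root_power_cancel)
    finally show "ereal (root t (a t)) \<le> ereal (root t (2 * K) * root t (real t) * G)" by simp
  qed
  also have "\<dots> = ereal G" using lim by (intro lim_imp_Limsup) auto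
  finally show ?thesis .
qed

text \<open>If the limsup were smaller, some \<open>Q < M * sqrt R\<close> would give
  \<open>a t \<le> Q ^ t\<close> eventually. The sum of two scaled even terms would then be of order
  \<open>(Q / M)^(2 n)\<close>, too small against \<open>c * R ^ n\<close>.\<close>

lemma limsup_root_ge:
  fixes a :: "nat \<Rightarrow> real"
  assumes M: "0 < M" and R: "0 < R" and c: "0 < c"
    and ge: "\<And>n. a (2 * n) / M ^ (2 * n) + a (2 * Suc n) / M ^ (2 * Suc n) \<ge> c * R ^ n"
  shows "limsup (\<lambda>t. ereal (root t (a t))) \<ge> ereal (M * sqrt R)"
proof (rule ccontr)
  assume "\<not> ?thesis"
  \<comment> \<open>Taking the maximum with 0 forces \<open>Q\<close> to be positive.\<close>
  then have "max 0 (limsup (\<lambda>t. ereal (root t (a t)))) < ereal (M * sqrt R)"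
    using M R by (simp add: not_le)
  from ereal_dense2[OF this] obtain Q where
    "max 0 (limsup (\<lambda>t. ereal (root t (a t)))) < ereal Q" "ereal Q < ereal (M * sqrt R)" by blast
  then have Q: "limsup (\<lambda>t. ereal (root t (a t))) < ereal Q" "0 < Q" "Q < M * sqrt R" by auto
  from Limsup_lessD[OF Q(1)] have "\<forall>\<^sub>F t in sequentially. root t (a t) < Q" by simp
  then obtain N where N: "\<And>t. t \<ge> N \<Longrightarrow> root t (a t) < Q"
    unfolding eventually_sequentially by blast
  have aQ: "a t \<le> Q ^ t" if "t \<ge> N" "t > 0" for t
  proof (cases "a t \<le> 0")
    case False
    then have "a t = root t (a t) ^ t" using that by simp
    also have "\<dots> \<le> Q ^ t" using N[OF that(1)] False that by (intro power_mono) auto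
    finally show ?thesis .
  qed (use Q in \<open>meson order_trans zero_le_power less_imp_le\<close>)
  \<comment> \<open>The ratio between the assumed growth of the even terms per cycle and the
    required growth \<open>R\<close>; it is below 1.\<close>
  define x where "x = (Q / M)\<^sup>2 / R"
  have x0: "0 \<le> x" using R by (simp add: x_def)
  have "(Q / M)\<^sup>2 < (sqrt R)\<^sup>2"
    using Q M by (intro power_strict_mono) (auto simp: divide_less_eq mult.commute)
  then have x1: "x < 1" using R by (simp add: x_def)
  have xR: "(Q / M)\<^sup>2 = x * R" using R by (simp add: x_def)
  have "c \<le> x ^ n * (1 + x * R)" if n: "n \<ge> Suc N" for n
  proof -
    have "c * R ^ n \<le> a (2 * n) / M ^ (2 * n) + a (2 * Suc n) / M ^ (2 * Suc n)" by (rule ge)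
    also have "\<dots> \<le> Q ^ (2 * n) / M ^ (2 * n) + Q ^ (2 * Suc n) / M ^ (2 * Suc n)"
      using n M by (intro add_mono divide_right_mono aQ) auto
    also have "\<dots> = (x * R) ^ n + (x * R) ^ Suc n"
      unfolding power_divide[symmetric] power_mult xR ..
    also have "\<dots> = x ^ n * (1 + x * R) * R ^ n"
      by (simp add: power_mult_distrib algebra_simps)
    finally show ?thesis using R by simp
  qed
  then have "\<forall>\<^sub>F n in sequentially. c \<le> x ^ n * (1 + x * R)"
    unfolding eventually_sequentially by blast
  moreover have "(\<lambda>n. x ^ n * (1 + x * R)) \<longlonglongrightarrow> 0 * (1 + x * R)"
    using x0 x1 by (intro tendsto_intros LIMSEQ_power_zero) auto
  ultimately have "c \<le> 0" by (auto intro: tendsto_lowerbound)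
  with c show False by simp
qed

text \<open>The upper bound is uniform over \<open>Lam\<close>, while the lower bound comes from the
  single maximizer \<open>l0\<close>. Writing \<open>max 1 s\<close> merges the regimes, because the
  growth factor is 1 for all \<open>s\<close> up to 1.\<close>

lemma hb_rate_factor_eq:
  assumes Lam: "compact Lam" and m: "0 < m" "m < 1"
    and le: "\<And>l. l \<in> Lam \<Longrightarrow> \<bar>hb_sigma h0 h1 m l\<bar> \<le> s"
    and attained: "l0 \<in> Lam" "\<bar>hb_sigma h0 h1 m l0\<bar> = s"
  shows "hb_rate_factor Lam [h0, h1] m = ereal (sqrt m * sqrt (cheb_growth (max 1 s)))"
proof (rule antisym)
  let ?R = "cheb_growth (max 1 s)"
  have R1: "1 \<le> ?R" by (simp add: cheb_growth_ge_one)
  obtain K where K: "0 < K" "\<And>l t. l \<in> Lam \<Longrightarrow>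
      \<bar>hb_poly [h0, h1] m l t\<bar> \<le> K * real (Suc t) * (sqrt m * sqrt ?R) ^ t"
    using hb_poly_upper[OF Lam m(1), of "max 1 s" h0 h1] le by (meson max.cobounded1 max.coboundedI2)
  have "hb_worst_rate Lam [h0, h1] m t \<le> K * real (Suc t) * (sqrt m * sqrt ?R) ^ t" for t
    using attained(1) K(2) by (intro hb_worst_rate_le) auto
  then show "hb_rate_factor Lam [h0, h1] m \<le> ereal (sqrt m * sqrt ?R)"
    unfolding hb_rate_factor_def using K(1) m R1 by (intro limsup_root_le) auto
  let ?w = "\<lambda>t. hb_poly [h0, h1] m l0 t / sqrt m ^ t"
  obtain c where c: "0 < c" "\<And>n. \<bar>?w (2 * n)\<bar> + \<bar>?w (2 * Suc n)\<bar> \<ge> c * ?R ^ n"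
    using hb_poly_lower[OF m, of h0 h1 l0] unfolding attained(2) by blast
  have w: "\<bar>?w t\<bar> \<le> hb_worst_rate Lam [h0, h1] m t / sqrt m ^ t" for t
    using hb_poly_le_worst_rate[OF attained(1) K(2)] m
    by (simp add: abs_divide divide_right_mono)
  show "ereal (sqrt m * sqrt ?R) \<le> hb_rate_factor Lam [h0, h1] m"
    unfolding hb_rate_factor_def
  proof (rule limsup_root_ge[OF _ _ c(1)])
    show "c * ?R ^ n \<le> hb_worst_rate Lam [h0, h1] m (2 * n) / sqrt m ^ (2 * n)
        + hb_worst_rate Lam [h0, h1] m (2 * Suc n) / sqrt m ^ (2 * Suc n)" for n
      using c(2)[of n] w[of "2 * n"] w[of "2 * Suc n"] by linarith
  qed (use m R1 in auto)
qed

section \<open>Maximum of the absolute value of sigma over the two intervals\<close>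

text \<open>A convex parabola is largest at an endpoint; it is smallest at its vertex if that lies
  in the interval, and otherwise at the endpoint nearest to it.\<close>

lemma abs_quadratic_le_on_interval:
  fixes k v B :: real
  assumes k: "0 < k" and l: "a \<le> l" "l \<le> b"
    and M: "\<bar>k * (a - v)\<^sup>2 + B\<bar> \<le> M" "\<bar>k * (b - v)\<^sup>2 + B\<bar> \<le> M"
      "a \<le> v \<Longrightarrow> v \<le> b \<Longrightarrow> \<bar>B\<bar> \<le> M"
  shows "\<bar>k * (l - v)\<^sup>2 + B\<bar> \<le> M"
proof -
  have mono: "k * x\<^sup>2 \<le> k * y\<^sup>2" if "\<bar>x\<bar> \<le> \<bar>y\<bar>" for x y
    using that k by (intro mult_left_mono) (auto simp: abs_le_square_iff)
  have "k * (l - v)\<^sup>2 + B \<le> M"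
  proof (cases "v \<le> l")
    case True
    then show ?thesis using mono[of "l - v" "b - v"] l M(2) by linarith
  next
    case False
    then show ?thesis using mono[of "l - v" "a - v"] l M(1) by linarith
  qed
  moreover have "- M \<le> k * (l - v)\<^sup>2 + B"
  proof -
    consider "v < a" | "a \<le> v" "v \<le> b" | "b < v" by linarith
    then show ?thesis
    proof cases
      case 1
      then show ?thesis using mono[of "a - v" "l - v"] l M(1) by linarith
    next
      case 2
      have "0 \<le> k * (l - v)\<^sup>2" using k by simp
      then show ?thesis using M(3)[OF 2] by linarith
    next
      case 3
      then show ?thesis using mono[of "b - v" "l - v"] l M(2) by linarith
    qed
  qed
  ultimately show ?thesis by linarith
qed

text \<open>Completing the square: \<open>v\<close> satisfies
  \<open>2 * h0 * h1 * v = (1 + m) * (h0 + h1)\<close>, which makes it the critical point of the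
  quadratic.\<close>

lemma hb_sigma_vertex_form:
  assumes "0 < m" "0 < h0" "0 < h1"
  defines "v \<equiv> (1 + m) * (h0 + h1) / (2 * h0 * h1)"
  shows "hb_sigma h0 h1 m l = h0 * h1 / (2 * m) * (l - v)\<^sup>2 + hb_sigma h0 h1 m v"
proof -
  have v: "2 * h0 * h1 * v = (1 + m) * (h0 + h1)" using assms by (simp add: v_def)
  have "2 * m * hb_sigma h0 h1 m l - 2 * m * hb_sigma h0 h1 m v
      = h0 * h1 * (l\<^sup>2 - v\<^sup>2) - (1 + m) * (h0 + h1) * (l - v)"
    unfolding hb_sigma_eq[OF assms(1)] by (simp add: algebra_simps power2_eq_square)
  also have "\<dots> = h0 * h1 * (l - v)\<^sup>2"
    unfolding v[symmetric] by (simp add: algebra_simps power2_eq_square)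
  finally show ?thesis using assms(1) by (simp add: field_simps)
qed

theorem theorem1:
  fixes \<mu>1 L1 \<mu>2 L2 m h0 h1 :: real
  assumes "0 < \<mu>1" "\<mu>1 < L1" "L1 \<le> \<mu>2" "\<mu>2 < L2" "L1 - \<mu>1 = L2 - \<mu>2"
    and "0 < m" "m < 1" "0 < h0" "0 < h1"
  defines "Lam \<equiv> {\<mu>1..L1} \<union> {\<mu>2..L2}"
    and "\<sigma>2 \<equiv> (\<lambda>l::real. 2 * ((1 + m - l * h0) / (2 * sqrt m))
                          * ((1 + m - l * h1) / (2 * sqrt m)) - 1)"
  defines "\<sigma>s \<equiv> Max ((\<lambda>l. \<bar>\<sigma>2 l\<bar>) `
                  ({\<mu>1, L1, \<mu>2, L2, (1 + m) * (h0 + h1) / (2 * h0 * h1)} \<inter> Lam))"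
  shows "(\<sigma>s \<le> 1 \<longrightarrow> hb_rate_factor Lam [h0, h1] m = ereal (sqrt m))
       \<and> (1 < \<sigma>s \<and> \<sigma>s < (1 + m\<^sup>2) / (2 * m) \<longrightarrow>
            hb_rate_factor Lam [h0, h1] m = ereal (sqrt m * sqrt (\<sigma>s + sqrt (\<sigma>s\<^sup>2 - 1))))
       \<and> (\<sigma>s \<ge> (1 + m\<^sup>2) / (2 * m) \<longrightarrow> hb_rate_factor Lam [h0, h1] m \<ge> 1)"
proof -
  define v where "v = (1 + m) * (h0 + h1) / (2 * h0 * h1)"
  define S where "S = {\<mu>1, L1, \<mu>2, L2, v} \<inter> Lam"
  have \<sigma>2: "\<sigma>2 = hb_sigma h0 h1 m" by (simp add: \<sigma>2_def hb_sigma_def fun_eq_iff)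
  have fin: "finite S" and ends: "{\<mu>1, L1, \<mu>2, L2} \<subseteq> S"
    using assms(2-4) by (auto simp: S_def Lam_def)
  have \<sigma>s: "\<sigma>s = Max ((\<lambda>l. \<bar>\<sigma>2 l\<bar>) ` S)" by (simp add: \<sigma>s_def S_def v_def)
  have S_le: "\<bar>\<sigma>2 l\<bar> \<le> \<sigma>s" if "l \<in> S" for l
    unfolding \<sigma>s using fin that by (intro Max_ge) auto
  have "\<sigma>s \<in> (\<lambda>l. \<bar>\<sigma>2 l\<bar>) ` S"
    unfolding \<sigma>s using fin ends by (intro Max_in) auto
  then obtain l0 where l0: "l0 \<in> Lam" "\<bar>\<sigma>2 l0\<bar> = \<sigma>s" by (auto simp: S_def)
  have vertex: "\<sigma>2 l = h0 * h1 / (2 * m) * (l - v)\<^sup>2 + \<sigma>2 v" for l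
    unfolding \<sigma>2 v_def by (rule hb_sigma_vertex_form[OF assms(6,8,9)])
  \<comment> \<open>Both endpoints belong to \<open>S\<close>, and so does the vertex whenever it
    falls in the interval, so \<open>\<sigma>s\<close> bounds all the values that determine the
    extremes.\<close>
  have interval: "\<bar>\<sigma>2 l\<bar> \<le> \<sigma>s" if "{a, b} \<subseteq> S" "{a..b} \<subseteq> Lam" "l \<in> {a..b}" for a b l
  proof (rule abs_quadratic_le_on_interval[of "h0 * h1 / (2 * m)" a l b v "\<sigma>2 v", folded vertex])
    show "\<bar>\<sigma>2 v\<bar> \<le> \<sigma>s" if "a \<le> v" "v \<le> b"
      using that \<open>{a..b} \<subseteq> Lam\<close> by (intro S_le) (auto simp: S_def)
  qed (use that assms(6,8,9) S_le in auto)
  have "\<bar>\<sigma>2 l\<bar> \<le> \<sigma>s" if "l \<in> Lam" for l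
    using that interval[of \<mu>1 L1 l] interval[of \<mu>2 L2 l] ends by (auto simp: Lam_def)
  \<comment> \<open>A compact interval minus an open gap is compact; the gap is empty when the two
    intervals touch.\<close>
  moreover have "Lam = {\<mu>1..L2} - {L1<..<\<mu>2}" using assms(2-4) by (auto simp: Lam_def)
  then have "compact Lam" by (simp add: compact_diff)
  ultimately have rate: "hb_rate_factor Lam [h0, h1] m = ereal (sqrt m * sqrt (cheb_growth (max 1 \<sigma>s)))"
    using hb_rate_factor_eq[of Lam m h0 h1 \<sigma>s l0] assms(6,7) l0 by (simp add: \<sigma>2)
  have "1 \<le> sqrt m * sqrt (cheb_growth (max 1 \<sigma>s))" if ge: "\<sigma>s \<ge> (1 + m\<^sup>2) / (2 * m)"
  proof -
    have "0 \<le> (1 - m)\<^sup>2" by simp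
    then have "1 \<le> (1 + m\<^sup>2) / (2 * m)" using assms(6) by (simp add: power2_eq_square algebra_simps)
    \<comment> \<open>At the threshold the growth factor is exactly \<open>1 / m\<close>, and
      monotonicity extends the bound to larger \<open>\<sigma>s\<close>.\<close>
    then have "1 / m \<le> cheb_growth (max 1 \<sigma>s)"
      using cheb_growth_mono[of "(1 + m\<^sup>2) / (2 * m)" "max 1 \<sigma>s"] cheb_growth_joukowski[of m] ge assms(6,7)
      by simp
    then have "1 \<le> m * cheb_growth (max 1 \<sigma>s)" using assms(6) by (simp add: field_simps)
    then show ?thesis by (simp add: real_sqrt_mult[symmetric])
  qed
  then show ?thesis unfolding rate by (auto simp: max_def cheb_growth_def)
qed

end
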